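(* Let $(A,\mu,\alpha)$ be a multiplicative Hom-Jordan algebra over $\mathbf{k}$, and write $xy=\mu(x,y)$. For $k\ge 0$ define the $(2^{k+1}+1)$-ary product $[,\ldots,]^{(k)}$ on $A$ inductively by setting $$[x_1,x_2,x_3]^{(0)} = 2\left(\alpha(x_1)(x_2x_3) - \alpha(x_2)(x_1x_3)\right)$$ and $$[x_1,\ldots,x_{2^{k+1}+1}]^{(k)} = \big[[x_1,\ldots,x_{2^k+1}]^{(k-1)},\alpha^{2^k}(x_{2^k+2}),\ldots,\alpha^{2^k}(x_{2^{k+1}+1})\big]^{(k-1)}$$ for $k\ge 1$ and $x_i\in A$. Then $$A_L^k = (A,[,\ldots,]^{(k)},\alpha^{2^{k+1}})$$ is a multiplicative $(2^{k+1}+1)$-ary Hom-Nambu algebra for each $k\ge 0$.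
   Context: $\mathbf{k}$ is a fixed field of characteristic $0$; $\alpha^m$ denotes $m$-fold composition. A multiplicative Hom-algebra $(A,\mu,\alpha)$ is a $\mathbf{k}$-module $A$ with a bilinear map $\mu\colon A\otimes A\to A$ (no associativity assumed) and a linear map $\alpha\colon A\to A$ such that $\alpha(\mu(x,y))=\mu(\alpha(x),\alpha(y))$. Its Hom-associator is $as_A(x,y,z) = (xy)\alpha(z) - \alpha(x)(yz)$. A Hom-Jordan algebra is a Hom-algebra $(A,\mu,\alpha)$ such that $\mu$ is commutative ($xy=yx$) and $as_A(x^2,\alpha(y),\alpha(x))=0$ for all $x,y\in A$, where $x^2=\mu(x,x)$. For $n\ge 2$, an $n$-ary Hom-algebra $(V,[,\ldots,],(\alpha_1,\ldots,\alpha_{n-1}))$ is a $\mathbf{k}$-module $V$ with an $n$-linear map $[,\ldots,]\colon V^{\otimes n}\to V$ and linear maps $\alpha_1,\ldots,\alpha_{n-1}\colon V\to V$ (the twisting maps). If all twisting maps equal one map $\gamma$ it is written $(V,[,\ldots,],\gamma)$; it is multiplicative if moreover $\gamma([x_1,\ldots,x_n])=[\gamma(x_1),\ldots,\gamma(x_n)]$. It is an $n$-ary Hom-Nambu algebra if for all $x_1,\ldots,x_{n-1},y_1,\ldots,y_n\in V$, $$[\alpha_1(x_1),\ldots,\alpha_{n-1}(x_{n-1}),[y_1,\ldots,y_n]] = \sum_{i=1}^n [\alpha_1(y_1),\ldots,\alpha_{i-1}(y_{i-1}),[x_1,\ldots,x_{n-1},y_i],\alpha_i(y_{i+1}),\ldots,\alpha_{n-1}(y_n)].$$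 *)

theory Defs
  imports Complex_Main
begin

text \<open>
  The underlying module of an algebra is the whole type \<open>'a\<close>, with scalar multiplication \<open>scale\<close>.
\<close>

locale hom_algebra = vector_space scale
  for scale :: "'k::field \<Rightarrow> 'a::ab_group_add \<Rightarrow> 'a" +
  fixes mu :: "'a \<Rightarrow> 'a \<Rightarrow> 'a" and \<alpha> :: "'a \<Rightarrow> 'a"
  assumes linear_mu_left: "\<And>y. Vector_Spaces.linear scale scale (\<lambda>x. mu x y)"
    and linear_mu_right: "\<And>x. Vector_Spaces.linear scale scale (\<lambda>y. mu x y)"
    and linear_twist: "Vector_Spaces.linear scale scale \<alpha>"

locale multiplicative_hom_algebra = hom_algebra +
  assumes twist_mu: "\<And>x y. \<alpha> (mu x y) = mu (\<alpha> x) (\<alpha> y)"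

definition hom_associator ::
    "('a::ab_group_add \<Rightarrow> 'a \<Rightarrow> 'a) \<Rightarrow> ('a \<Rightarrow> 'a) \<Rightarrow> 'a \<Rightarrow> 'a \<Rightarrow> 'a \<Rightarrow> 'a" where
  "hom_associator mu \<alpha> x y z = mu (mu x y) (\<alpha> z) - mu (\<alpha> x) (mu y z)"

locale hom_jordan_algebra = hom_algebra +
  assumes mu_commute: "\<And>x y. mu x y = mu y x"
    and hom_jordan_identity: "\<And>x y. hom_associator mu \<alpha> (mu x x) (\<alpha> y) (\<alpha> x) = 0"

locale multiplicative_hom_jordan_algebra = hom_jordan_algebra + multiplicative_hom_algebra

text \<open>
  An \<open>n\<close>-ary product is a function on lists of which only the values on lists of length \<open>n\<close>
  matter; the twisting maps form a list of length \<open>n - 1\<close>. List positions count from 0, so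
  \<open>x\<^sub>i\<close> is \<open>xs ! (i - 1)\<close>.
\<close>

definition nary_linear ::
    "('k::field \<Rightarrow> 'a::ab_group_add \<Rightarrow> 'a) \<Rightarrow> nat \<Rightarrow> ('a list \<Rightarrow> 'a) \<Rightarrow> bool" where
  "nary_linear scale n br \<longleftrightarrow>
    (\<forall>xs i. length xs = n \<longrightarrow> i < n \<longrightarrow>
      Vector_Spaces.linear scale scale (\<lambda>v. br (xs[i := v])))"

locale nary_hom_algebra = vector_space scale
  for scale :: "'k::field \<Rightarrow> 'a::ab_group_add \<Rightarrow> 'a" +
  fixes n :: nat and br :: "'a list \<Rightarrow> 'a" and \<alpha>s :: "('a \<Rightarrow> 'a) list"
  assumes arity_ge_2: "n \<ge> 2"
    and nary_linear_bracket: "nary_linear scale n br"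
    and length_twists: "length \<alpha>s = n - 1"
    and linear_twists: "\<And>f. f \<in> set \<alpha>s \<Longrightarrow> Vector_Spaces.linear scale scale f"

definition apply_twists :: "('a \<Rightarrow> 'a) list \<Rightarrow> 'a list \<Rightarrow> 'a list" where
  "apply_twists fs xs = map2 (\<lambda>f x. f x) fs xs"

text \<open>
  In the \<open>i\<close>-th summand the entries of \<open>ys\<close> before position \<open>i\<close> carry the twisting map of the
  same index, those after position \<open>i\<close> the twisting map of index one less.
\<close>

locale nary_hom_nambu_algebra = nary_hom_algebra +
  assumes hom_nambu_identity:
    "\<And>xs ys. length xs = n - 1 \<Longrightarrow> length ys = n \<Longrightarrow>
      br (apply_twists \<alpha>s xs @ [br ys]) =
      (\<Sum>i<n. br (apply_twists (take i \<alpha>s) (take i ys)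
                 @ [br (xs @ [ys ! i])]
                 @ apply_twists (drop i \<alpha>s) (drop (Suc i) ys)))"

locale multiplicative_nary_hom_nambu_algebra =
  nary_hom_nambu_algebra scale n br "replicate (n - 1) \<gamma>"
  for scale :: "'k::field \<Rightarrow> 'a::ab_group_add \<Rightarrow> 'a" and n :: nat
    and br :: "'a list \<Rightarrow> 'a" and \<gamma> :: "'a \<Rightarrow> 'a" +
  assumes twist_bracket: "\<And>xs. length xs = n \<Longrightarrow> \<gamma> (br xs) = br (map \<gamma> xs)"

text \<open>\<open>jordan_bracket scale mu \<alpha> k\<close> is meant for lists of length \<open>2 ^ (k + 1) + 1\<close>.\<close>

primrec jordan_bracket ::
    "('k::field \<Rightarrow> 'a::ab_group_add \<Rightarrow> 'a) \<Rightarrow> ('a \<Rightarrow> 'a \<Rightarrow> 'a) \<Rightarrow> ('a \<Rightarrow> 'a) \<Rightarrow> nat \<Rightarrow> 'a list \<Rightarrow> 'a"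
where
  "jordan_bracket scale mu \<alpha> 0 xs =
    scale 2 (mu (\<alpha> (xs ! 0)) (mu (xs ! 1) (xs ! 2)) - mu (\<alpha> (xs ! 1)) (mu (xs ! 0) (xs ! 2)))"
| "jordan_bracket scale mu \<alpha> (Suc k) xs =
    jordan_bracket scale mu \<alpha> k
      (jordan_bracket scale mu \<alpha> k (take (2 ^ Suc k + 1) xs)
       # map (\<alpha> ^^ (2 ^ Suc k)) (drop (2 ^ Suc k + 1) xs))"

end

theory Submission
  imports Defs
begin

text \<open>
  For a fixed list \<open>xs\<close> of \<open>n - 1\<close> entries let \<open>D\<close> be the adjoint map \<open>y \<mapsto> br (xs @ [y])\<close> of an
  \<open>n\<close>-ary bracket. The Hom-Nambu identity with one twisting map \<open>\<gamma>\<close> says that the adjoint map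
  of \<open>map \<gamma> xs\<close> acts on a bracket by the Leibniz rule: \<open>D\<close> hits one entry and \<open>\<gamma>\<close> all the others.
  The proof is an induction on \<open>k\<close>, and its core is to pass on Leibniz rules.

  For \<open>k = 0\<close> the adjoint map is, up to the factor 2, the Hom-version
  \<open>D a b t = (\<alpha> a)(b t) - (\<alpha> b)(a t)\<close> of the commutator of two multiplications.
  In a Jordan algebra this commutator is a derivation of the product, and the reason survives
  the twisting: one side of the linearized Jordan identity is symmetric in all four variables,
  so exchanging two of them on the other side gives a Leibniz rule of \<open>D\<close> for \<open>mu\<close>
  (\<open>hom_jordan_inner_derivation\<close>). The ternary bracket is built from \<open>mu\<close> and \<open>\<alpha>\<close>, and \<open>D\<close>
  is compatible with \<open>\<alpha>\<close> by multiplicativity, so the rule passes on to the bracket, with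
  twisting map \<open>\<alpha>\<^sup>2\<close> (\<open>hom_jordan_ternary_hom_nambu\<close>).

  The step from \<open>k\<close> to \<open>k + 1\<close> has nothing to do with Jordan algebras: inserting a multiplicative
  \<open>n\<close>-ary Hom-Nambu bracket into the first slot of itself, with \<open>\<gamma>\<close> on the remaining slots,
  gives a multiplicative \<open>(2n - 1)\<close>-ary Hom-Nambu bracket with twisting map \<open>\<gamma>\<^sup>2\<close>
  (\<open>doubled_bracket_hom_nambu\<close>). An adjoint map of the new bracket is an adjoint map of the
  old one after \<open>\<gamma>\<close>, and the Leibniz rule is applied once to the outer and once to the inner bracket.
\<close>

section \<open>Hom-Nambu algebras with a single twisting map\<close>

lemma apply_twists_replicate:
  "length xs = m \<Longrightarrow> apply_twists (replicate m \<gamma>) xs = map \<gamma> xs"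
  by (induction xs arbitrary: m) (auto simp: apply_twists_def)

lemma hom_nambu_summand_eq_list_update:
  assumes "length ys = n" "i < n"
  shows "apply_twists (take i (replicate (n - 1) \<gamma>)) (take i ys) @ [v]
           @ apply_twists (drop i (replicate (n - 1) \<gamma>)) (drop (Suc i) ys)
         = (map \<gamma> ys)[i := v]"
proof -
  have "take i (replicate (n - 1) \<gamma>) = replicate i \<gamma>"
    using assms by (simp add: min_def)
  moreover have "drop i (replicate (n - 1) \<gamma>) = replicate (n - Suc i) \<gamma>"
    using assms by simp
  ultimately show ?thesis
    using assms by (simp add: apply_twists_replicate upd_conv_take_nth_drop take_map drop_map)
qed

text \<open>
  With all twisting maps equal, the two blocks of twisted entries around position \<open>i\<close> merge, and
  each summand is \<open>map \<gamma> ys\<close> with a single entry replaced. This form of the Leibniz rule is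
  the one that fits the list updates in the definition of multilinearity.
\<close>

lemma multiplicative_nary_hom_nambu_algebra_iff:
  fixes scale :: "'k::field \<Rightarrow> 'a::ab_group_add \<Rightarrow> 'a"
  assumes n: "n \<ge> 2"
  shows "multiplicative_nary_hom_nambu_algebra scale n br \<gamma> \<longleftrightarrow>
    vector_space scale \<and> nary_linear scale n br \<and> Vector_Spaces.linear scale scale \<gamma> \<and>
    (\<forall>xs. length xs = n \<longrightarrow> \<gamma> (br xs) = br (map \<gamma> xs)) \<and>
    (\<forall>xs ys. length xs = n - 1 \<longrightarrow> length ys = n \<longrightarrow>
      br (map \<gamma> xs @ [br ys]) = (\<Sum>i<n. br ((map \<gamma> ys)[i := br (xs @ [ys ! i])])))"
proof -
  have "(\<forall>f. f \<in> set (replicate (n - 1) \<gamma>) \<longrightarrow> Vector_Spaces.linear scale scale f)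
      \<longleftrightarrow> Vector_Spaces.linear scale scale \<gamma>"
    using n by simp
  moreover have "(\<Sum>i<n. br (apply_twists (take i (replicate (n - 1) \<gamma>)) (take i ys) @ [br (xs @ [ys ! i])]
           @ apply_twists (drop i (replicate (n - 1) \<gamma>)) (drop (Suc i) ys)))
         = (\<Sum>i<n. br ((map \<gamma> ys)[i := br (xs @ [ys ! i])]))"
    if "length ys = n" for xs ys
    by (intro sum.cong refl arg_cong[where f = br] hom_nambu_summand_eq_list_update that) simp
  ultimately show ?thesis
    unfolding multiplicative_nary_hom_nambu_algebra_def
      multiplicative_nary_hom_nambu_algebra_axioms_def nary_hom_nambu_algebra_def
      nary_hom_nambu_algebra_axioms_def nary_hom_algebra_def nary_hom_algebra_axioms_def
    using n by (auto simp: apply_twists_replicate)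
qed

lemma linear_funpow:
  assumes "Vector_Spaces.linear scale scale f"
  shows "Vector_Spaces.linear scale scale (f ^^ m)"
proof (induction m)
  case 0
  interpret Vector_Spaces.linear scale scale f by fact
  show ?case using vs1.linear_id by (simp add: id_def)
next
  case (Suc m)
  show ?case
    unfolding funpow.simps(2) by (rule Vector_Spaces.linear_compose[OF Suc assms])
qed

section \<open>Doubling the arity\<close>

definition doubled_bracket :: "nat \<Rightarrow> ('a list \<Rightarrow> 'a) \<Rightarrow> ('a \<Rightarrow> 'a) \<Rightarrow> 'a list \<Rightarrow> 'a" where
  "doubled_bracket n br \<gamma> zs = br (br (take n zs) # map \<gamma> (drop n zs))"

lemma doubled_bracket_update_less:
  "i < n \<Longrightarrow> doubled_bracket n br \<gamma> (zs[i := v])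
    = br ((br (take n zs) # map \<gamma> (drop n zs))[0 := br ((take n zs)[i := v])])"
  by (simp add: doubled_bracket_def take_update_swap)

lemma doubled_bracket_update_ge:
  "n \<le> i \<Longrightarrow> doubled_bracket n br \<gamma> (zs[i := v])
    = br ((br (take n zs) # map \<gamma> (drop n zs))[Suc (i - n) := \<gamma> v])"
  by (simp add: doubled_bracket_def drop_update_swap map_update)

lemma nary_linear_doubled_bracket:
  assumes br: "nary_linear scale n br" and \<gamma>: "Vector_Spaces.linear scale scale \<gamma>" and "n \<ge> 1"
  shows "nary_linear scale (2 * n - 1) (doubled_bracket n br \<gamma>)"
  unfolding nary_linear_def
proof (intro allI impI)
  fix zs :: "'b list" and i
  assume len: "length zs = 2 * n - 1" and i: "i < 2 * n - 1"
  define us where "us = br (take n zs) # map \<gamma> (drop n zs)"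
  have us: "length us = n" using len \<open>n \<ge> 1\<close> by (simp add: us_def)
  have slot: "Vector_Spaces.linear scale scale (\<lambda>v. br (ws[j := v]))"
    if "length ws = n" "j < n" for ws j
    using br that unfolding nary_linear_def by blast
  show "Vector_Spaces.linear scale scale (\<lambda>v. doubled_bracket n br \<gamma> (zs[i := v]))"
  proof (cases "i < n")
    case True
    have "Vector_Spaces.linear scale scale ((\<lambda>v. br (us[0 := v])) \<circ> (\<lambda>v. br ((take n zs)[i := v])))"
      by (rule Vector_Spaces.linear_compose[OF slot slot]) (use us len True in auto)
    then show ?thesis using True by (simp add: doubled_bracket_update_less us_def o_def)
  next
    case False
    have "Vector_Spaces.linear scale scale ((\<lambda>v. br (us[Suc (i - n) := v])) \<circ> \<gamma>)"
      by (rule Vector_Spaces.linear_compose[OF \<gamma> slot]) (use us i False in auto)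
    then show ?thesis using False by (simp add: doubled_bracket_update_ge us_def o_def)
  qed
qed

text \<open>
  The list \<open>es\<close> of \<open>n - 1\<close> entries is made so that \<open>br (es @ [\<gamma> y])\<close> is the new bracket of \<open>xs @ [y]\<close>.
  The left-hand side of the identity to be proved is the adjoint map of \<open>map \<gamma> (map \<gamma> es)\<close>
  applied to an old bracket, which the old identity expands. In the summands of the tail slots
  the adjoint map of \<open>map \<gamma> es\<close> meets an entry \<open>\<gamma> (\<gamma> y)\<close> and equals \<open>\<gamma>\<close> of the new
  adjoint map at \<open>y\<close>; in the summand of slot 0 it meets the inner bracket, and a second use of
  the old identity produces the remaining \<open>n\<close> summands.
\<close>

theorem doubled_bracket_hom_nambu:
  assumes "multiplicative_nary_hom_nambu_algebra scale n br \<gamma>"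
  shows "multiplicative_nary_hom_nambu_algebra scale (2 * n - 1) (doubled_bracket n br \<gamma>) (\<gamma> ^^ 2)"
proof -
  interpret multiplicative_nary_hom_nambu_algebra scale n br \<gamma> by fact
  note n = arity_ge_2
  let ?B = "doubled_bracket n br \<gamma>"
  have br: "nary_linear scale n br" and \<gamma>: "Vector_Spaces.linear scale scale \<gamma>"
    and mult: "\<And>xs. length xs = n \<Longrightarrow> \<gamma> (br xs) = br (map \<gamma> xs)"
    and nambu: "\<And>xs ys. length xs = n - 1 \<Longrightarrow> length ys = n \<Longrightarrow>
      br (map \<gamma> xs @ [br ys]) = (\<Sum>i<n. br ((map \<gamma> ys)[i := br (xs @ [ys ! i])]))"
    using assms unfolding multiplicative_nary_hom_nambu_algebra_iff[OF n] by blast+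
  have square: "\<gamma> ^^ 2 = (\<lambda>v. \<gamma> (\<gamma> v))"
    by (simp add: numeral_2_eq_2 o_def)
  have mult_B: "\<gamma> (?B zs) = ?B (map \<gamma> zs)" if "length zs = 2 * n - 1" for zs
    using that n by (simp add: doubled_bracket_def mult take_map drop_map)
  have nambu_B: "?B (map (\<lambda>v. \<gamma> (\<gamma> v)) xs @ [?B ys])
      = (\<Sum>i<2 * n - 1. ?B ((map (\<lambda>v. \<gamma> (\<gamma> v)) ys)[i := ?B (xs @ [ys ! i])]))"
      (is "_ = (\<Sum>i<_. ?term i)")
    if xs: "length xs = 2 * n - 1 - 1" and ys: "length ys = 2 * n - 1" for xs ys
  proof -
    define es where "es = br (take n xs) # map \<gamma> (drop n xs)"
    define us where "us = map \<gamma> (take n ys)"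
    define ws where "ws = br us # map (\<lambda>v. \<gamma> (\<gamma> v)) (drop n ys)"
    have es: "length es = n - 1" and us: "length us = n" and ws: "length ws = n"
      using xs ys n by (simp_all add: es_def us_def ws_def)
    have es_act: "br (es @ [\<gamma> y]) = ?B (xs @ [y])" for y
      using xs n by (simp add: es_def doubled_bracket_def)
    have twisted_es_act: "br (map \<gamma> es @ [\<gamma> (\<gamma> y)]) = \<gamma> (?B (xs @ [y]))" for y
      using mult[of "es @ [\<gamma> y]"] es n by (simp add: es_act)
    \<comment> \<open>The new bracket puts one further \<open>\<gamma>\<close> on its last argument, which is here a new bracket itself.\<close>
    have B_ys: "\<gamma> (?B ys) = br ws"
      unfolding mult_B[OF ys]
      by (simp add: doubled_bracket_def us_def ws_def take_map drop_map o_def)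
    have head: "br ((map \<gamma> ws)[0 := br (map \<gamma> es @ [ws ! 0])]) = (\<Sum>i<n. ?term i)"
    proof -
      have "Vector_Spaces.linear scale scale (\<lambda>v. br ((map \<gamma> ws)[0 := v]))"
        using br ws n unfolding nary_linear_def by simp
      then interpret slot: Vector_Spaces.linear scale scale "\<lambda>v. br ((map \<gamma> ws)[0 := v])" .
      have "br (map \<gamma> es @ [ws ! 0]) = (\<Sum>i<n. br ((map \<gamma> us)[i := br (es @ [us ! i])]))"
        using nambu[OF es us] by (simp add: ws_def)
      then have "br ((map \<gamma> ws)[0 := br (map \<gamma> es @ [ws ! 0])])
          = (\<Sum>i<n. br ((map \<gamma> ws)[0 := br ((map \<gamma> us)[i := br (es @ [us ! i])])]))"
        by (simp only: slot.sum)
      also have "\<dots> = (\<Sum>i<n. ?term i)"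
      proof (rule sum.cong[OF refl])
        fix i assume "i \<in> {..<n}"
        then have i: "i < n" by simp
        then have "us ! i = \<gamma> (ys ! i)" using ys by (simp add: us_def)
        with i show "br ((map \<gamma> ws)[0 := br ((map \<gamma> us)[i := br (es @ [us ! i])])]) = ?term i"
          by (simp add: doubled_bracket_update_less es_act)
            (simp add: ws_def us_def take_map drop_map o_def)
      qed
      finally show ?thesis .
    qed
    have tail: "br ((map \<gamma> ws)[Suc j := br (map \<gamma> es @ [ws ! Suc j])]) = ?term (n + j)"
      if "j < n - 1" for j
    proof -
      have "ws ! Suc j = \<gamma> (\<gamma> (ys ! (n + j)))"
        using that ys by (simp add: ws_def)
      then show ?thesis
        by (simp add: doubled_bracket_update_ge twisted_es_act)
          (simp add: ws_def us_def mult ys take_map drop_map o_def)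
    qed
    have split: "(\<Sum>i<n + m. h i) = (\<Sum>i<n. h i) + (\<Sum>j<m. h (n + j))" for m and h :: "nat \<Rightarrow> 'b"
      by (induction m) (simp_all add: add.assoc)
    have "?B (map (\<lambda>v. \<gamma> (\<gamma> v)) xs @ [?B ys]) = br (map \<gamma> (map \<gamma> es) @ [br ws])"
      unfolding B_ys[symmetric]
      using xs n by (simp add: doubled_bracket_def[of n br \<gamma> "_ @ _"] es_def mult take_map drop_map o_def)
    also have "\<dots> = (\<Sum>j<Suc (n - 1). br ((map \<gamma> ws)[j := br (map \<gamma> es @ [ws ! j])]))"
      using n by (subst nambu) (simp_all add: es ws)
    also have "\<dots> = (\<Sum>i<n. ?term i) + (\<Sum>j<n - 1. ?term (n + j))"
      unfolding sum.lessThan_Suc_shift head by (simp add: tail)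
    also have "\<dots> = (\<Sum>i<n + (n - 1). ?term i)"
      by (rule split[symmetric])
    also have "n + (n - 1) = 2 * n - 1" by simp
    finally show ?thesis .
  qed
  have "\<gamma> (\<gamma> (?B zs)) = ?B (map (\<lambda>v. \<gamma> (\<gamma> v)) zs)" if "length zs = 2 * n - 1" for zs
    using that by (simp add: mult_B o_def)
  moreover have "2 * n - 1 \<ge> 2" using n by simp
  moreover have "nary_linear scale (2 * n - 1) ?B"
    by (rule nary_linear_doubled_bracket[OF br \<gamma>]) (use n in simp)
  ultimately show ?thesis
    using nambu_B linear_funpow[OF \<gamma>, of 2] vector_space_axioms
    by (subst multiplicative_nary_hom_nambu_algebra_iff) (auto simp only: square)
qed

section \<open>The ternary bracket of a Hom-Jordan algebra\<close>

text \<open>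
  The part \<open>P u v\<close> of \<open>f (u + v) (u + v) (u + v)\<close> that is quadratic in \<open>u\<close> satisfies
  \<open>P u v = - P v u\<close>, so it is additive in \<open>u\<close> because it is in \<open>v\<close>; its defect of additivity
  in \<open>u\<close>, which therefore vanishes, is the sum over all permutations of the arguments.
\<close>

lemma polarization:
  fixes f :: "'a::ab_group_add \<Rightarrow> 'a \<Rightarrow> 'a \<Rightarrow> 'b::ab_group_add"
  assumes "\<And>a a' b c. f (a + a') b c = f a b c + f a' b c"
    and "\<And>a b b' c. f a (b + b') c = f a b c + f a b' c"
    and "\<And>a b c c'. f a b (c + c') = f a b c + f a b c'"
    and diag: "\<And>a. f a a a = 0"
  shows "f a b c + f a c b + f b a c + f b c a + f c a b + f c b a = 0"
proof -
  define P where "P = (\<lambda>u v. f u u v + f u v u + f v u u)"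
  have cubic: "P u v + P v u = 0" for u v
  proof -
    have "f (u + v) (u + v) (u + v) = f u u u + f v v v + (P u v + P v u)"
      by (simp add: P_def assms(1-3) add_ac)
    then show ?thesis by (simp add: diag)
  qed
  have "P (a + b) c = P a c + P b c
      + (f a b c + f a c b + f b a c + f b c a + f c a b + f c b a)"
    by (simp add: P_def assms(1-3) add_ac)
  moreover have "P c (a + b) = P c a + P c b"
    by (simp add: P_def assms(1-3) add_ac)
  ultimately have "P (a + b) c + P c (a + b) = (P a c + P c a) + (P b c + P c b)
      + (f a b c + f a c b + f b a c + f b c a + f c a b + f c b a)"
    by (simp add: add_ac)
  then show ?thesis by (simp add: cubic)
qed

text \<open>
  Polarizing the Jordan identity in \<open>x\<close> gives each of three terms twice, whence the need to
  divide by 2. In the result \<open>cyclic\<close> the right-hand side is the sum over the three ways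
  of splitting \<open>{x, y, z, w}\<close> into two pairs, hence symmetric in \<open>y\<close> and \<open>w\<close>. The left-hand side
  is therefore symmetric in \<open>y\<close> and \<open>w\<close> as well, and this symmetry, rearranged, is the Leibniz rule.
\<close>

lemma hom_jordan_inner_derivation:
  fixes scale :: "'k::field \<Rightarrow> 'a::ab_group_add \<Rightarrow> 'a"
  assumes "multiplicative_hom_jordan_algebra scale mu \<alpha>" and two: "(2::'k) \<noteq> 0"
  defines "D \<equiv> \<lambda>a b t. mu (\<alpha> a) (mu b t) - mu (\<alpha> b) (mu a t)"
  shows "D (\<alpha> a) (\<alpha> b) (mu x z) = mu (\<alpha> (\<alpha> x)) (D a b z) + mu (D a b x) (\<alpha> (\<alpha> z))"
proof -
  interpret multiplicative_hom_jordan_algebra scale mu \<alpha> by fact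
  interpret l: Vector_Spaces.linear scale scale "\<lambda>s. mu s c" for c by (rule linear_mu_left)
  interpret r: Vector_Spaces.linear scale scale "mu c" for c by (rule linear_mu_right)
  interpret t: Vector_Spaces.linear scale scale \<alpha> by (rule linear_twist)
  note lin = l.add r.add t.add l.diff r.diff t.diff
  have cyclic: "mu (mu (mu x z) (\<alpha> y)) (\<alpha> (\<alpha> w)) + mu (mu (mu z w) (\<alpha> y)) (\<alpha> (\<alpha> x))
        + mu (mu (mu w x) (\<alpha> y)) (\<alpha> (\<alpha> z))
      = mu (mu (\<alpha> x) (\<alpha> z)) (mu (\<alpha> y) (\<alpha> w)) + mu (mu (\<alpha> z) (\<alpha> w)) (mu (\<alpha> y) (\<alpha> x))
        + mu (mu (\<alpha> w) (\<alpha> x)) (mu (\<alpha> y) (\<alpha> z))" (is "?l = ?r") for x y z w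
  proof -
    define f where "f = (\<lambda>a b c. hom_associator mu \<alpha> (mu a b) (\<alpha> y) (\<alpha> c))"
    have sym: "f b a c = f a b c" for a b c by (simp add: f_def mu_commute)
    have "f x z w + f x w z + f z x w + f z w x + f w x z + f w z x = 0"
      by (rule polarization[of f x z w])
        (simp_all add: f_def hom_associator_def lin hom_jordan_identity[unfolded hom_associator_def])
    then have "(?l - ?r) + (?l - ?r) = 0"
      unfolding sym[of z x] sym[of w z] sym[of x w]
      by (simp add: f_def hom_associator_def twist_mu algebra_simps)
    then have "scale 2 (?l - ?r) = 0"
      using scale_left_distrib[of 1 1 "?l - ?r"] by simp
    then show "?l = ?r" using two by simp
  qed
  have exchange: "mu (\<alpha> (\<alpha> w)) (mu (\<alpha> y) (mu x z)) + mu (\<alpha> (\<alpha> x)) (mu (\<alpha> y) (mu w z))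
        + mu (\<alpha> (\<alpha> z)) (mu (\<alpha> y) (mu w x))
      = mu (\<alpha> (\<alpha> y)) (mu (\<alpha> w) (mu x z)) + mu (\<alpha> (\<alpha> x)) (mu (\<alpha> w) (mu y z))
        + mu (\<alpha> (\<alpha> z)) (mu (\<alpha> w) (mu y x))" (is "?L w y = ?L y w") for w y
  proof -
    define R where "R = (\<lambda>w y. mu (mu (\<alpha> x) (\<alpha> z)) (mu (\<alpha> y) (\<alpha> w))
        + mu (mu (\<alpha> z) (\<alpha> w)) (mu (\<alpha> y) (\<alpha> x)) + mu (mu (\<alpha> w) (\<alpha> x)) (mu (\<alpha> y) (\<alpha> z)))"
    have "?L w y = R w y" for w y
      using cyclic[of x z y w] by (simp add: R_def mu_commute)
    moreover have "R w y = R y w"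
      by (simp add: R_def mu_commute add_ac)
    ultimately show ?thesis by simp
  qed
  have "D (\<alpha> a) (\<alpha> b) (mu x z) = mu (\<alpha> (\<alpha> x)) (D a b z) + mu (\<alpha> (\<alpha> z)) (D a b x)"
    using exchange[of a b] unfolding D_def lin by (simp (no_asm_use) add: algebra_simps)
  then show ?thesis by (simp only: mu_commute[of "D a b x"])
qed

text \<open>
  The bracket of \<open>u, v, w\<close> is a difference of products \<open>mu (\<alpha> u) (mu v w)\<close>. Applying
  the derivation rule of \<open>D\<close> to the outer and then to the inner product, and moving \<open>D\<close> past \<open>\<alpha>\<close>
  by multiplicativity, lets \<open>D\<close> act on one of the three letters and \<open>\<alpha>\<^sup>2\<close> on the others.
\<close>

theorem hom_jordan_ternary_hom_nambu:
  fixes scale :: "'k::field \<Rightarrow> 'a::ab_group_add \<Rightarrow> 'a"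
  assumes J: "multiplicative_hom_jordan_algebra scale mu \<alpha>" and two: "(2::'k) \<noteq> 0"
  shows "multiplicative_nary_hom_nambu_algebra scale 3 (jordan_bracket scale mu \<alpha> 0) (\<alpha> ^^ 2)"
proof -
  interpret multiplicative_hom_jordan_algebra scale mu \<alpha> by fact
  interpret l: Vector_Spaces.linear scale scale "\<lambda>s. mu s c" for c by (rule linear_mu_left)
  interpret r: Vector_Spaces.linear scale scale "mu c" for c by (rule linear_mu_right)
  interpret t: Vector_Spaces.linear scale scale \<alpha> by (rule linear_twist)
  note lin = l.add r.add t.add l.diff r.diff t.diff l.scale r.scale t.scale
  let ?br = "jordan_bracket scale mu \<alpha> 0"
  define D where "D = (\<lambda>a b t. mu (\<alpha> a) (mu b t) - mu (\<alpha> b) (mu a t))"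
  have br: "?br [a, b, t] = scale 2 (D a b t)" for a b t
    by (simp add: D_def)
  have D_twist: "D (\<alpha> a) (\<alpha> b) (\<alpha> t) = \<alpha> (D a b t)" for a b t
    by (simp add: D_def twist_mu lin)
  have D_mu: "D (\<alpha> a) (\<alpha> b) (mu x z) = mu (\<alpha> (\<alpha> x)) (D a b z) + mu (D a b x) (\<alpha> (\<alpha> z))"
    for a b x z
    unfolding D_def by (rule hom_jordan_inner_derivation[OF J two])
  have lin_D: "Vector_Spaces.linear scale scale (D a b)"
     "Vector_Spaces.linear scale scale (\<lambda>a. D a b t)"
     "Vector_Spaces.linear scale scale (\<lambda>b. D a b t)" for a b t
    unfolding D_def Vector_Spaces.linear_iff
    by (simp_all add: lin vector_space_axioms scale_right_diff_distrib)
  have D_scale: "D a b (scale c t) = scale c (D a b t)" "D (scale c a) b t = scale c (D a b t)"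
     "D a (scale c b) t = scale c (D a b t)" for a b t c
    by (simp_all add: D_def lin scale_right_diff_distrib)
  have D_diff: "D a b (s - t) = D a b s - D a b t" for a b s t
    by (simp add: D_def lin algebra_simps)
  have nested: "D (\<alpha> (\<alpha> a)) (\<alpha> (\<alpha> b)) (D u v w)
     = D (D a b u) (\<alpha> (\<alpha> v)) (\<alpha> (\<alpha> w)) + D (\<alpha> (\<alpha> u)) (D a b v) (\<alpha> (\<alpha> w))
       + D (\<alpha> (\<alpha> u)) (\<alpha> (\<alpha> v)) (D a b w)" for a b u v w
  proof -
    have "D (\<alpha> (\<alpha> a)) (\<alpha> (\<alpha> b)) (D u v w)
       = D (\<alpha> (\<alpha> a)) (\<alpha> (\<alpha> b)) (mu (\<alpha> u) (mu v w)) - D (\<alpha> (\<alpha> a)) (\<alpha> (\<alpha> b)) (mu (\<alpha> v) (mu u w))"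
      by (simp add: D_def[THEN fun_cong, of u, THEN fun_cong, of v, THEN fun_cong, of w] D_diff)
    then show ?thesis
      by (simp add: D_mu D_twist lin twist_mu)
        (simp add: D_def twist_mu lin algebra_simps)
  qed
  interpret D: vector_space_pair scale scale ..
  have "nary_linear scale 3 ?br"
    unfolding nary_linear_def
  proof (intro allI impI)
    fix xs :: "'a list" and i :: nat
    assume "length xs = 3" "i < 3"
    then obtain a b c where xs: "xs = [a, b, c]"
      by (auto simp: numeral_3_eq_3 length_Suc_conv)
    from \<open>i < 3\<close> consider "i = 0" | "i = 1" | "i = 2" by linarith
    then show "Vector_Spaces.linear scale scale (\<lambda>v. ?br (xs[i := v]))"
      by cases (simp_all add: xs br numeral_2_eq_2 lin_D D.linear_compose_scale_right
          del: jordan_bracket.simps)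
  qed
  moreover have "(\<alpha> ^^ 2) (?br xs) = ?br (map (\<alpha> ^^ 2) xs)" if len: "length xs = 3" for xs
  proof -
    from len obtain a b c where xs: "xs = [a, b, c]"
      by (auto simp: numeral_3_eq_3 length_Suc_conv)
    show ?thesis by (simp add: xs lin twist_mu numeral_2_eq_2)
  qed
  moreover have "?br (map (\<alpha> ^^ 2) xs @ [?br ys])
      = (\<Sum>i<3. ?br ((map (\<alpha> ^^ 2) ys)[i := ?br (xs @ [ys ! i])]))"
    if len: "length xs = 3 - 1" "length ys = 3" for xs ys
  proof -
    from len obtain a b u v w where xs: "xs = [a, b]" and ys: "ys = [u, v, w]"
      by (auto simp: numeral_3_eq_3 length_Suc_conv)
    \<comment> \<open>As a general rewrite rule \<open>nested\<close> would loop: it applies to its own last summand.\<close>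
    show ?thesis
      by (simp add: xs ys br nested[of a b u v w] D_scale numeral_2_eq_2 numeral_3_eq_3
          scale_right_distrib add.assoc del: jordan_bracket.simps)
  qed
  ultimately show ?thesis
    using linear_funpow[OF linear_twist] vector_space_axioms
    by (subst multiplicative_nary_hom_nambu_algebra_iff) (auto simp del: jordan_bracket.simps)
qed

theorem corollary4p3:
  fixes scale :: "'k::field_char_0 \<Rightarrow> 'a::ab_group_add \<Rightarrow> 'a"
    and mu :: "'a \<Rightarrow> 'a \<Rightarrow> 'a" and \<alpha> :: "'a \<Rightarrow> 'a" and k :: nat
  assumes "multiplicative_hom_jordan_algebra scale mu \<alpha>"
  shows "multiplicative_nary_hom_nambu_algebra scale (2 ^ (k + 1) + 1)
           (jordan_bracket scale mu \<alpha> k) (\<alpha> ^^ (2 ^ (k + 1)))"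
proof (induction k)
  case 0
  show ?case using hom_jordan_ternary_hom_nambu[OF assms] by (simp del: jordan_bracket.simps)
next
  case (Suc k)
  have "jordan_bracket scale mu \<alpha> (Suc k)
      = doubled_bracket (2 ^ (k + 1) + 1) (jordan_bracket scale mu \<alpha> k) (\<alpha> ^^ (2 ^ (k + 1)))"
    by (simp add: fun_eq_iff doubled_bracket_def)
  moreover have "(\<alpha> ^^ (2 ^ (k + 1))) ^^ 2 = \<alpha> ^^ (2 ^ (Suc k + 1))"
    by (simp add: funpow_mult mult.commute)
  ultimately show ?case
    using doubled_bracket_hom_nambu[OF Suc] by (simp add: mult_2)
qed

end
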